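(* For all finite connected graphs $G$ and $H$, we have $z(G \square H)\leq z(G)+z(H)$, where $G \square H$ denotes the Cartesian product of $G$ and $H$.
   Context: The game of Zombies and Survivor on a finite connected graph: first a set of zombies is placed on vertices, then a single survivor chooses a vertex. Then the players alternate rounds: each zombie moves along an edge following some shortest path (geodesic) from its current position to the survivor, so each zombie's distance to the survivor decreases by one (if several shortest paths exist, the zombies may choose which one to follow — the deterministic version); then the survivor moves to an adjacent vertex or stays put. The zombies win if some zombie moves onto the vertex of the survivor. The zombie number $z(G)$ is the minimum number of zombies such that the zombies have a strategy guaranteeing capture of the survivor in finite time regardless of how the survivor plays. The Cartesian product $G \square H$ has vertex set $V(G)\times V(H)$, with $(g,h)$ adjacent to $(g',h')$ iff either $g=g'$ and $hh'\in E(H)$, or $h=h'$ and $gg'\in E(G)$. *)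

theory Defs
  imports "Graph_Theory.Graph_Theory"
begin

text \<open>
  A finite simple graph is a \<^locale>\<open>pair_graph\<close>: a finite, symmetric and loop-free arc relation on a
  finite vertex set. The library's \<^const>\<open>connected\<close> includes that there is at least one vertex.
\<close>

definition cartesian_product ::
  "'a pair_pre_digraph \<Rightarrow> 'b pair_pre_digraph \<Rightarrow> ('a \<times> 'b) pair_pre_digraph" (infixl \<open>\<box>\<close> 70) where
  "G \<box> H = \<lparr> pverts = pverts G \<times> pverts H,
     parcs = {((g, h), (g', h')).
       (g = g' \<and> g \<in> pverts G \<and> (h, h') \<in> parcs H) \<or>
       (h = h' \<and> h \<in> pverts H \<and> (g, g') \<in> parcs G)} \<rparr>"

definition geodesic :: "'a pair_pre_digraph \<Rightarrow> 'a \<Rightarrow> 'a vwalk \<Rightarrow> 'a \<Rightarrow> bool" where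
  "geodesic G u p v \<longleftrightarrow>
     vpath p G \<and> hd p = u \<and> last p = v \<and>
     (\<forall>q. vpath q G \<and> hd q = u \<and> last q = v \<longrightarrow> vwalk_length p \<le> vwalk_length q)"

text \<open>A zombie on \<open>x\<close> may move to \<open>y\<close> when the survivor is on \<open>v\<close>.\<close>

definition zombie_move :: "'a pair_pre_digraph \<Rightarrow> 'a \<Rightarrow> 'a \<Rightarrow> 'a \<Rightarrow> bool" where
  "zombie_move G v x y \<longleftrightarrow> (\<exists>p. geodesic G x (x # y # p) v)"

text \<open>
  In every round the zombies move first. \<open>s t\<close> is the survivor's vertex after \<open>t\<close> rounds; \<open>s 0\<close> is
  the vertex chosen in the placement phase.
\<close>

definition survivor_play :: "'a pair_pre_digraph \<Rightarrow> (nat \<Rightarrow> 'a) \<Rightarrow> bool" where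
  "survivor_play G s \<longleftrightarrow>
     s 0 \<in> pverts G \<and> (\<forall>t. s (Suc t) = s t \<or> (s t, s (Suc t)) \<in> parcs G)"

text \<open>
  A strategy for zombies \<open>0, 1, \<dots>, k - 1\<close> maps the list of the survivor's positions seen so far to
  the next position of each zombie. Its value on the empty list is the initial placement.
  The survivor's history determines that of the zombies, so nothing else needs to be remembered.
\<close>

type_synonym 'a zombie_strategy = "'a list \<Rightarrow> nat \<Rightarrow> 'a"

text \<open>The position of zombie \<open>i\<close> after \<open>t\<close> rounds, which depends on \<open>s 0, \<dots>, s (t - 1)\<close> only.\<close>

definition zombie_pos :: "'a zombie_strategy \<Rightarrow> (nat \<Rightarrow> 'a) \<Rightarrow> nat \<Rightarrow> nat \<Rightarrow> 'a" where
  "zombie_pos \<sigma> s t = \<sigma> (map s [0..<t])"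

text \<open>
  The survivor is caught in round \<open>t\<close> if a zombie moves onto the survivor, who is still on \<open>s (t - 1)\<close>,
  or if the survivor then moves to (or stays on) a vertex \<open>s t\<close> occupied by a zombie. For \<open>t = 0\<close> the
  truncated subtraction makes both conditions say that the survivor starts on a zombie's vertex.
\<close>

definition caught :: "nat \<Rightarrow> 'a zombie_strategy \<Rightarrow> (nat \<Rightarrow> 'a) \<Rightarrow> nat \<Rightarrow> bool" where
  "caught k \<sigma> s t \<longleftrightarrow> (\<exists>i<k. zombie_pos \<sigma> s t i = s (t - 1) \<or> zombie_pos \<sigma> s t i = s t)"

text \<open>The rules bind the zombies only as long as the survivor has not been caught.\<close>

definition legal_strategy :: "'a pair_pre_digraph \<Rightarrow> nat \<Rightarrow> 'a zombie_strategy \<Rightarrow> bool" where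
  "legal_strategy G k \<sigma> \<longleftrightarrow>
     (\<forall>i<k. \<sigma> [] i \<in> pverts G) \<and>
     (\<forall>s t. survivor_play G s \<and> (\<forall>r\<le>t. \<not> caught k \<sigma> s r) \<longrightarrow>
        (\<forall>i<k. zombie_move G (s t) (zombie_pos \<sigma> s t i) (zombie_pos \<sigma> s (Suc t) i)))"

definition winning_strategy :: "'a pair_pre_digraph \<Rightarrow> nat \<Rightarrow> 'a zombie_strategy \<Rightarrow> bool" where
  "winning_strategy G k \<sigma> \<longleftrightarrow>
     legal_strategy G k \<sigma> \<and> (\<forall>s. survivor_play G s \<longrightarrow> (\<exists>t. caught k \<sigma> s t))"

definition zombie_number :: "'a pair_pre_digraph \<Rightarrow> nat" where
  "zombie_number G = (LEAST k. \<exists>\<sigma>. winning_strategy G k \<sigma>)"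

text \<open>The minimum is over a nonempty set: place a zombie on every vertex.\<close>

lemma winning_strategy_exists:
  assumes "pair_graph G"
  shows "\<exists>k \<sigma>. winning_strategy G k \<sigma>"
proof -
  interpret pair_graph G by fact
  obtain f where f: "bij_betw f {0..<card (pverts G)} (pverts G)"
    using ex_bij_betw_nat_finite pair_finite_verts by blast
  let ?\<sigma> = "\<lambda>_. f"
  have c: "caught (card (pverts G)) ?\<sigma> s 0" if "survivor_play G s" for s
  proof -
    have "s 0 \<in> f ` {0..<card (pverts G)}"
      using that f by (simp add: survivor_play_def bij_betw_def)
    then show ?thesis by (auto simp: caught_def zombie_pos_def)
  qed
  have "f i \<in> pverts G" if "i < card (pverts G)" for i
    using that f by (auto simp: bij_betw_def)
  then have "winning_strategy G (card (pverts G)) ?\<sigma>"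
    using c by (auto simp: winning_strategy_def legal_strategy_def)
  then show ?thesis by blast
qed

end

theory Submission
  imports Defs
begin

text \<open>
  Play with a team of \<open>z(G)\<close> zombies and a team of \<open>z(H)\<close> zombies. The members of the first team all
  have the same \<open>H\<close>-coordinate. While it differs from the survivor's, they all make the same step
  towards the survivor in \<open>H\<close>; when it agrees, they make the next move of a winning strategy in \<open>G\<close>.
  The survivor's \<open>G\<close>-coordinates at the times of the latter kind form a play in \<open>G\<close>, since the team
  answers each of the survivor's moves in \<open>H\<close> by restoring the agreement. If this play is infinite, the
  team catches the survivor. The distance between the two \<open>H\<close>-coordinates never grows during
  steps in \<open>H\<close>, and it drops whenever the survivor does not move in \<open>H\<close>, so the play is infinite if
  infinitely many of the survivor's moves are not in \<open>H\<close>. The second team acts symmetrically, and no move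
  is both in \<open>G\<close> and in \<open>H\<close>.
\<close>

subsection \<open>Zombie moves and distances\<close>

lemma length_vwalk_to_vpath_le: "length (vwalk_to_vpath p) \<le> length p"
proof (induction p rule: vwalk_to_vpath.induct)
  case (2 x xs)
  have "length (dropWhile (\<lambda>y. y \<noteq> x) xs) \<le> length xs" by (rule length_dropWhile_le)
  with 2 show ?case by (cases "x \<in> set xs") auto
qed simp

lemma length_vwalk_to_vpath_less:
  "\<not> distinct p \<Longrightarrow> length (vwalk_to_vpath p) < length p"
proof (induction p rule: vwalk_to_vpath.induct)
  case (2 x xs)
  have "length (vwalk_to_vpath (dropWhile (\<lambda>y. y \<noteq> x) xs)) \<le> length xs"
    using length_vwalk_to_vpath_le length_dropWhile_le le_trans by blast
  with 2 show ?case by (cases "x \<in> set xs") auto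
qed simp

context pair_wf_digraph
begin

lemma vwalk_imp_relpow:
  "vwalk p (with_proj G) \<Longrightarrow> (hd p, last p) \<in> parcs G ^^ (length p - 1)"
proof (induction p rule: vwalk_arcs.induct)
  case (3 x y xs)
  then have "(x, y) \<in> parcs G" "(y, last (y # xs)) \<in> parcs G ^^ length xs" by auto
  then have "(x, last (y # xs)) \<in> parcs G ^^ Suc (length xs)" by (rule relpow_Suc_I2)
  then show ?case by simp
qed (auto simp: vwalk_def)

lemma relpow_imp_vwalk:
  assumes "(x, y) \<in> parcs G ^^ n" "x \<in> pverts G"
  shows "\<exists>p. vwalk (x # p) (with_proj G) \<and> last (x # p) = y \<and> length p = n"
  using assms
proof (induction n arbitrary: x)
  case 0
  then show ?case by auto
next
  case (Suc n)
  then obtain z where z: "(x, z) \<in> parcs G" "(z, y) \<in> parcs G ^^ n"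
    by (meson relpow_Suc_D2)
  then obtain p where "vwalk (z # p) (with_proj G)" "last (z # p) = y" "length p = n"
    using Suc.IH in_arcsD2 by blast
  with z show ?case by (intro exI[of _ "z # p"]) auto
qed

text \<open>Shortcutting a walk never lengthens it, so minimality among paths is minimality among
  walks; a minimal walk is a path because shortcutting strictly shortens a walk with a repetition.
  The bound is \<open>Suc m\<close> because a walk with \<open>m\<close> arcs lists one vertex
  more.\<close>

lemma geodesic_iff:
  "geodesic G x p v \<longleftrightarrow> vwalk p (with_proj G) \<and> hd p = x \<and> last p = v \<and>
     (\<forall>m. (x, v) \<in> parcs G ^^ m \<longrightarrow> length p \<le> Suc m)" (is "?L \<longleftrightarrow> ?R")
proof
  assume L: ?L
  then have p: "vwalk p (with_proj G)" "p \<noteq> []" "x \<in> pverts G"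
    by (auto simp: geodesic_def vpath_def vwalk_def)
  have "length p \<le> Suc m" if m: "(x, v) \<in> parcs G ^^ m" for m
  proof -
    obtain q where q: "vwalk (x # q) (with_proj G)" "last (x # q) = v" "length q = m"
      using relpow_imp_vwalk[OF m p(3)] by blast
    let ?q = "vwalk_to_vpath (x # q)"
    have "vpath ?q (with_proj G)" "hd ?q = x" "last ?q = v"
      using q vwalk_to_vpath_vpath[OF q(1)] by (simp_all only: vwalk_to_vpath_hd vwalk_to_vpath_last list.sel)
    then have "length p - 1 \<le> length ?q - 1"
      using L by (simp add: geodesic_def)
    with length_vwalk_to_vpath_le[of "x # q"] q(3) show ?thesis by (simp del: vwalk_to_vpath.simps)
  qed
  with L show ?R by (auto simp: geodesic_def vpath_def)
next
  assume R: ?R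
  have "distinct p"
  proof (rule ccontr)
    assume nd: "\<not> distinct p"
    let ?q = "vwalk_to_vpath p"
    have q: "vwalk ?q (with_proj G)" "hd ?q = x" "last ?q = v"
      using R vwalk_to_vpath_vpath vwalk_to_vpath_hd[of p] vwalk_to_vpath_last[of p]
      by (auto simp: vpath_def)
    from vwalk_imp_relpow[OF q(1)] q R have "length p \<le> Suc (length ?q - 1)" by auto
    moreover have "?q \<noteq> []" using q(1) by (auto simp: vwalk_def)
    then have "Suc (length ?q - 1) = length ?q" by simp
    ultimately show False using length_vwalk_to_vpath_less[OF nd] by simp
  qed
  moreover have "length p \<le> length q"
    if "vpath q (with_proj G)" "hd q = x" "last q = v" for q
  proof -
    have "vwalk q (with_proj G)" "q \<noteq> []" using that by (auto simp: vpath_def vwalk_def)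
    with vwalk_imp_relpow[OF this(1)] that R have "length p \<le> Suc (length q - 1)" by metis
    with \<open>q \<noteq> []\<close> show ?thesis by (cases q) auto
  qed
  ultimately show ?L using R by (auto simp: geodesic_def vpath_def diff_le_mono)
qed

text \<open>Powers of the arc relation replace paths because they decompose well in products. The
  \<open>n\<close> here is the distance from \<open>y\<close> to \<open>v\<close>, and
  \<open>x\<close> is one farther away.\<close>

lemma zombie_move_iff:
  "zombie_move G v x y \<longleftrightarrow>
     (x, y) \<in> parcs G \<and> (\<exists>n. (y, v) \<in> parcs G ^^ n \<and> (\<forall>m\<le>n. (x, v) \<notin> parcs G ^^ m))"
  (is "?L \<longleftrightarrow> ?R")
proof
  assume ?L
  then obtain p where p: "geodesic G x (x # y # p) v" by (auto simp: zombie_move_def)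
  then have "(x, y) \<in> parcs G" "vwalk (y # p) (with_proj G)" "last (y # p) = v"
    by (auto simp: geodesic_iff)
  moreover from vwalk_imp_relpow[OF this(2)] this(3) have "(y, v) \<in> parcs G ^^ length p" by auto
  moreover have "(x, v) \<notin> parcs G ^^ m" if "m \<le> length p" for m
    using p that by (fastforce simp: geodesic_iff)
  ultimately show ?R by blast
next
  assume ?R
  then obtain n where n: "(x, y) \<in> parcs G" "(y, v) \<in> parcs G ^^ n"
    "\<And>m. m \<le> n \<Longrightarrow> (x, v) \<notin> parcs G ^^ m" by blast
  then obtain p where "vwalk (y # p) (with_proj G)" "last (y # p) = v" "length p = n"
    using relpow_imp_vwalk in_arcsD2 by blast
  with n have "geodesic G x (x # y # p) v"
    by (auto simp: geodesic_iff not_less_eq_eq[symmetric])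
  then show ?L by (auto simp: zombie_move_def)
qed

lemma exists_zombie_move:
  assumes "(x, v) \<in> (parcs G)\<^sup>*" "x \<noteq> v"
  shows "\<exists>y. zombie_move G v x y"
proof -
  obtain k where k: "(x, v) \<in> parcs G ^^ k" "\<And>m. m < k \<Longrightarrow> (x, v) \<notin> parcs G ^^ m"
    using assms(1) exists_least_iff[of "\<lambda>k. (x, v) \<in> parcs G ^^ k"] by (auto simp: rtrancl_power)
  with assms(2) obtain n where n: "k = Suc n" by (cases k) auto
  with k obtain y where "(x, y) \<in> parcs G" "(y, v) \<in> parcs G ^^ n" by (meson relpow_Suc_D2)
  with k n show ?thesis unfolding zombie_move_iff by (meson le_imp_less_Suc)
qed

end

lemma connected_imp_rtrancl:
  assumes "pair_graph G" "connected (with_proj G)" "x \<in> pverts G" "y \<in> pverts G"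
  shows "(x, y) \<in> (parcs G)\<^sup>*"
proof -
  interpret pair_graph G by fact
  have "x \<rightarrow>\<^sup>*\<^bsub>with_proj G\<^esub> y"
    using assms by (auto simp: connected_def strongly_connected_def reachable_mk_symmetric_eq[OF pair_sym_arcs])
  then show ?thesis by (auto simp: reachable_def intro: rtrancl_on_rtranclI)
qed

subsection \<open>Zombie moves in Cartesian products\<close>

text \<open>Each arc of the product consists of an arc of one factor and a fixed vertex of the
  other. Hence the distance in the product is at least the sum of the distances in the
  factors.\<close>

lemma relpow_cartesian_product_split:
  assumes "(p, q) \<in> parcs (G \<box> H) ^^ m"
  shows "\<exists>a b. a + b = m \<and> (fst p, fst q) \<in> parcs G ^^ a \<and> (snd p, snd q) \<in> parcs H ^^ b"
  using assms
proof (induction m arbitrary: q)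
  case 0
  then show ?case by auto
next
  case (Suc m)
  then obtain r where r: "(p, r) \<in> parcs (G \<box> H) ^^ m" "(r, q) \<in> parcs (G \<box> H)" by auto
  from Suc.IH[OF r(1)] obtain a b where ab: "a + b = m" "(fst p, fst r) \<in> parcs G ^^ a"
    "(snd p, snd r) \<in> parcs H ^^ b" by blast
  from r(2) consider "fst r = fst q" "(snd r, snd q) \<in> parcs H"
    | "snd r = snd q" "(fst r, fst q) \<in> parcs G"
    by (auto simp: cartesian_product_def)
  then show ?case
  proof cases
    case 1
    with ab show ?thesis by (intro exI[of _ a] exI[of _ "Suc b"]) auto
  next
    case 2
    with ab show ?thesis by (intro exI[of _ "Suc a"] exI[of _ b]) auto
  qed
qed

lemma relpow_cartesian_product_fst:
  "(x, u) \<in> parcs G ^^ n \<Longrightarrow> h \<in> pverts H \<Longrightarrow> ((x, h), (u, h)) \<in> parcs (G \<box> H) ^^ n"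
  by (induction n arbitrary: u) (auto simp: cartesian_product_def intro!: relcompI)

lemma relpow_cartesian_product_snd:
  "(h, v) \<in> parcs H ^^ n \<Longrightarrow> x \<in> pverts G \<Longrightarrow> ((x, h), (x, v)) \<in> parcs (G \<box> H) ^^ n"
  by (induction n arbitrary: v) (auto simp: cartesian_product_def intro!: relcompI)

lemma pair_wf_digraph_cartesian_product:
  assumes "pair_wf_digraph G" "pair_wf_digraph H"
  shows "pair_wf_digraph (G \<box> H)"
  using assms by (auto simp: pair_wf_digraph_def cartesian_product_def)

lemma zombie_move_fst:
  assumes wf: "pair_wf_digraph G" "pair_wf_digraph H"
    and move: "zombie_move G u x x'" and h: "h \<in> pverts H"
  shows "zombie_move (G \<box> H) (u, h) (x, h) (x', h)"
proof -
  interpret G: pair_wf_digraph G by fact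
  interpret P: pair_wf_digraph "G \<box> H" by (rule pair_wf_digraph_cartesian_product[OF wf])
  from move obtain n where "(x, x') \<in> parcs G" and n: "(x', u) \<in> parcs G ^^ n"
    "\<forall>m\<le>n. (x, u) \<notin> parcs G ^^ m" by (auto simp: G.zombie_move_iff)
  then have "((x, h), (x', h)) \<in> parcs (G \<box> H)" using h by (simp add: cartesian_product_def)
  moreover have "((x', h), (u, h)) \<in> parcs (G \<box> H) ^^ n"
    using n(1) h by (rule relpow_cartesian_product_fst)
  moreover have "((x, h), (u, h)) \<notin> parcs (G \<box> H) ^^ m" if "m \<le> n" for m
    using n(2) that by (auto dest!: relpow_cartesian_product_split)
  ultimately show ?thesis unfolding P.zombie_move_iff by blast
qed

text \<open>Distances add up in the product, so a step that shortens the distance in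
  \<open>H\<close> lies on a geodesic even when the first coordinates differ.\<close>

lemma zombie_move_snd:
  assumes wf: "pair_wf_digraph G" "pair_wf_digraph H"
    and move: "zombie_move H v h h'" and x: "x \<in> pverts G" and xu: "(x, u) \<in> (parcs G)\<^sup>*"
  shows "zombie_move (G \<box> H) (u, v) (x, h) (x, h')"
proof -
  interpret H: pair_wf_digraph H by fact
  interpret P: pair_wf_digraph "G \<box> H" by (rule pair_wf_digraph_cartesian_product[OF wf])
  from move obtain n where hh: "(h, h') \<in> parcs H" and n: "(h', v) \<in> parcs H ^^ n"
    "\<forall>m\<le>n. (h, v) \<notin> parcs H ^^ m" by (auto simp: H.zombie_move_iff)
  \<comment> \<open>\<open>a\<close> is the distance from \<open>x\<close> to \<open>u\<close> in
    \<open>G\<close>.\<close>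
  obtain a where a: "(x, u) \<in> parcs G ^^ a" "\<And>m. m < a \<Longrightarrow> (x, u) \<notin> parcs G ^^ m"
    using xu exists_least_iff[of "\<lambda>k. (x, u) \<in> parcs G ^^ k"] by (auto simp: rtrancl_power)
  have v: "v \<in> pverts H"
    using H.relpow_imp_vwalk[OF n(1)] hh H.in_arcsD2 by (metis last_in_set list.distinct(1)
      subsetD vwalkE with_proj_simps(1))
  have "((x, h'), (x, v)) \<in> parcs (G \<box> H) ^^ n"
    using n(1) x by (rule relpow_cartesian_product_snd)
  then have "((x, h'), (u, v)) \<in> parcs (G \<box> H) ^^ (n + a)"
    using relpow_cartesian_product_fst[OF a(1) v] by (auto simp: relpow_add)
  moreover have "((x, h), (u, v)) \<notin> parcs (G \<box> H) ^^ m" if m: "m \<le> n + a" for m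
  proof
    assume "((x, h), (u, v)) \<in> parcs (G \<box> H) ^^ m"
    then obtain c d where cd: "c + d = m" "(x, u) \<in> parcs G ^^ c" "(h, v) \<in> parcs H ^^ d"
      by (auto dest!: relpow_cartesian_product_split)
    \<comment> \<open>The walk needs at least \<open>a\<close> arcs in \<open>G\<close>, and more
      than \<open>n\<close> in \<open>H\<close> because \<open>h\<close> is farther than
      \<open>n\<close> from \<open>v\<close>.\<close>
    have "a \<le> c" "n < d" using a(2) n(2) cd by (meson not_le)+
    with m cd show False by simp
  qed
  moreover have "((x, h), (x, h')) \<in> parcs (G \<box> H)" using hh x by (simp add: cartesian_product_def)
  ultimately show ?thesis unfolding P.zombie_move_iff by blast
qed

text \<open>The second team arises from the first by exchanging the factors; this and the next two
  lemmas carry arcs and distances across the exchange.\<close>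

lemma arc_swap: "(prod.swap p, prod.swap q) \<in> parcs (H \<box> G) \<longleftrightarrow> (p, q) \<in> parcs (G \<box> H)"
  by (cases p; cases q) (auto simp: cartesian_product_def)

lemma relpow_swapI:
  "(p, q) \<in> parcs (G \<box> H) ^^ n \<Longrightarrow> (prod.swap p, prod.swap q) \<in> parcs (H \<box> G) ^^ n"
proof (induction n arbitrary: q)
  case (Suc n)
  then obtain r where "(p, r) \<in> parcs (G \<box> H) ^^ n" "(r, q) \<in> parcs (G \<box> H)" by auto
  with Suc.IH arc_swap show ?case by (intro relpow_Suc_I) blast+
qed simp

lemma relpow_swap:
  "(prod.swap p, prod.swap q) \<in> parcs (H \<box> G) ^^ n \<longleftrightarrow> (p, q) \<in> parcs (G \<box> H) ^^ n"
  using relpow_swapI[of p q n G H] relpow_swapI[of "prod.swap p" "prod.swap q" n H G] by auto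

subsection \<open>The team of one factor\<close>

text \<open>The state consists of the team's common \<open>H\<close>-coordinate and the survivor's history in the game
  on \<open>G\<close>.\<close>

fun team_step :: "('b \<Rightarrow> 'b \<Rightarrow> 'b) \<Rightarrow> 'a \<times> 'b \<Rightarrow> 'b \<times> 'a list \<Rightarrow> 'b \<times> 'a list" where
  "team_step f (u, v) (h, us) = (if h = v then (h, us @ [u]) else (f h v, us))"

definition team_state :: "('b \<Rightarrow> 'b \<Rightarrow> 'b) \<Rightarrow> 'b \<Rightarrow> ('a \<times> 'b) list \<Rightarrow> 'b \<times> 'a list" where
  "team_state f h\<^sub>0 ps = fold (team_step f) ps (h\<^sub>0, [])"

text \<open>\<open>\<sigma>\<close> sees only the recorded first coordinates, so the team's own
  first coordinates stand still while it steps in \<open>H\<close>.\<close>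

definition team_strategy ::
  "('b \<Rightarrow> 'b \<Rightarrow> 'b) \<Rightarrow> 'b \<Rightarrow> 'a zombie_strategy \<Rightarrow> ('a \<times> 'b) zombie_strategy" where
  "team_strategy f h\<^sub>0 \<sigma> ps i = (\<sigma> (snd (team_state f h\<^sub>0 ps)) i, fst (team_state f h\<^sub>0 ps))"

text \<open>Fixing one play \<open>s\<close> turns the team's state into functions \<open>h\<close>
  and \<open>us\<close> of time. The strategy itself does not depend on \<open>s\<close>, so results
  for single plays combine to facts about it.\<close>

locale team_play =
  fixes G :: "'a pair_pre_digraph" and H :: "'b pair_pre_digraph"
    and f :: "'b \<Rightarrow> 'b \<Rightarrow> 'b" and h\<^sub>0 :: 'b and k :: nat and \<sigma> :: "'a zombie_strategy"
    and s :: "nat \<Rightarrow> 'a \<times> 'b"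
  assumes pair_graph_G: "pair_graph G" and pair_graph_H: "pair_graph H"
    and reach_G: "\<And>x y. x \<in> pverts G \<Longrightarrow> y \<in> pverts G \<Longrightarrow> (x, y) \<in> (parcs G)\<^sup>*"
    and reach_H: "\<And>x y. x \<in> pverts H \<Longrightarrow> y \<in> pverts H \<Longrightarrow> (x, y) \<in> (parcs H)\<^sup>*"
    and f: "\<And>h v. h \<in> pverts H \<Longrightarrow> v \<in> pverts H \<Longrightarrow> h \<noteq> v \<Longrightarrow> zombie_move H v h (f h v)"
    and h\<^sub>0: "h\<^sub>0 \<in> pverts H"
    and legal: "legal_strategy G k \<sigma>"
    and play: "survivor_play (G \<box> H) s"
begin

sublocale G: pair_graph G by (rule pair_graph_G)
sublocale H: pair_graph H by (rule pair_graph_H)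

abbreviation "\<rho> \<equiv> team_strategy f h\<^sub>0 \<sigma>"
abbreviation "u t \<equiv> fst (s t)"
abbreviation "v t \<equiv> snd (s t)"

definition h :: "nat \<Rightarrow> 'b" where
  "h t = fst (team_state f h\<^sub>0 (map s [0..<t]))"

definition us :: "nat \<Rightarrow> 'a list" where
  "us t = snd (team_state f h\<^sub>0 (map s [0..<t]))"

lemma zombie_pos_team: "zombie_pos \<rho> s t i = (\<sigma> (us t) i, h t)"
  by (simp add: zombie_pos_def team_strategy_def h_def us_def)

lemma h_0 [simp]: "h 0 = h\<^sub>0" and us_0 [simp]: "us 0 = []"
  by (simp_all add: h_def us_def team_state_def)

lemma team_state_Suc:
  "team_state f h\<^sub>0 (map s [0..<Suc t]) = team_step f (u t, v t) (h t, us t)"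
  by (simp add: h_def us_def team_state_def)

lemma h_Suc: "h (Suc t) = (if h t = v t then h t else f (h t) (v t))"
  and us_Suc: "us (Suc t) = (if h t = v t then us t @ [u t] else us t)"
  unfolding h_def[of "Suc t"] us_def[of "Suc t"] team_state_Suc by (simp_all del: prod.collapse)

lemma survivor_move:
  "v (Suc t) = v t \<and> (u (Suc t) = u t \<or> (u t, u (Suc t)) \<in> parcs G) \<or>
   u (Suc t) = u t \<and> (v t, v (Suc t)) \<in> parcs H"
proof -
  have "s (Suc t) = s t \<or> (s t, s (Suc t)) \<in> parcs (G \<box> H)"
    using play by (simp add: survivor_play_def)
  then show ?thesis by (auto simp: cartesian_product_def split_beta)
qed

lemma survivor_in_verts: "u t \<in> pverts G \<and> v t \<in> pverts H"
proof (induction t)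
  case 0
  then show ?case using play by (auto simp: survivor_play_def cartesian_product_def)
next
  case (Suc t)
  then show ?case using survivor_move[of t] G.in_arcsD2 H.in_arcsD2 by auto
qed

lemma h_in_verts: "h t \<in> pverts H"
proof (induction t)
  case (Suc t)
  then show ?case
    using f[of "h t" "v t"] survivor_in_verts[of t] H.in_arcsD2 by (auto simp: h_Suc H.zombie_move_iff)
qed (simp add: h\<^sub>0)

section \<open>Shadowing the survivor's second coordinate\<close>

lemma f_adjacent:
  assumes "(h t, v t) \<in> parcs H"
  shows "h (Suc t) = v t"
proof -
  have "h t \<noteq> v t" using assms H.no_loops' by auto
  with f[of "h t" "v t"] h_in_verts survivor_in_verts
  obtain n where n: "(h (Suc t), v t) \<in> parcs H ^^ n" "\<forall>m\<le>n. (h t, v t) \<notin> parcs H ^^ m"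
    by (auto simp: H.zombie_move_iff h_Suc)
  \<comment> \<open>An arc is a walk of length one, so \<open>n\<close> cannot reach 1.\<close>
  have "n = 0" using n(2) assms by (metis One_nat_def Suc_leI not_gr_zero relpow_1)
  with n(1) show ?thesis by simp
qed

text \<open>Once the team shares the survivor's second coordinate, it recovers it immediately after each
  survivor's move in \<open>H\<close>, hence before the first coordinate changes.\<close>

lemma last_us:
  assumes "us t \<noteq> []"
  shows "h t = v t \<and> (u t = last (us t) \<or> (last (us t), u t) \<in> parcs G) \<or>
    (h t, v t) \<in> parcs H \<and> u t = last (us t)"
  using assms
proof (induction t)
  case (Suc t)
  \<comment> \<open>In both cases the zombies' move brings the team to the survivor's current second
    coordinate, with the current first coordinate as last entry. The survivor's answer then yields
    the two alternatives.\<close>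
  have "h (Suc t) = v t \<and> last (us (Suc t)) = u t"
  proof (cases "h t = v t")
    case True
    then show ?thesis by (simp add: h_Suc us_Suc)
  next
    case False
    with Suc f_adjacent show ?thesis by (auto simp: us_Suc)
  qed
  with survivor_move[of t] show ?case by auto
qed simp

section \<open>The recorded play in the first factor\<close>

text \<open>This is what \<open>survivor_play\<close> demands of a finite initial part of a
  play.\<close>

definition walk_list :: "'a list \<Rightarrow> bool" where
  "walk_list xs \<longleftrightarrow> (xs \<noteq> [] \<longrightarrow> hd xs \<in> pverts G) \<and>
     successively (\<lambda>x y. y = x \<or> (x, y) \<in> parcs G) xs"

lemma walk_list_appendD: "walk_list (xs @ ys) \<Longrightarrow> walk_list xs"
  by (cases "xs = []") (simp_all add: walk_list_def successively_append_iff)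

text \<open>An entry is added only at a time of agreement, when \<open>last_us\<close> makes it
  equal or adjacent to the previous one; the other alternative there would be a loop in
  \<open>H\<close>.\<close>

lemma walk_list_us: "walk_list (us t)"
proof (induction t)
  case (Suc t)
  then show ?case
    using last_us[of t] survivor_in_verts[of t] H.no_loops'
    by (cases "us t = []") (auto simp: us_Suc walk_list_def successively_append_iff)
qed (simp add: walk_list_def)

lemma survivor_play_walk_list:
  assumes "\<And>n. walk_list (map s' [0..<n])"
  shows "survivor_play G s'"
proof -
  have "s' 0 \<in> pverts G" using assms[of 1] by (simp add: walk_list_def)
  moreover have "s' (Suc t) = s' t \<or> (s' t, s' (Suc t)) \<in> parcs G" for t
    using assms[of "Suc (Suc t)"] by (simp add: walk_list_def successively_append_iff)
  ultimately show ?thesis by (simp add: survivor_play_def)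
qed

text \<open>Legality of \<open>\<sigma>\<close> speaks of infinite plays only, so a finite record is
  continued by a survivor who stays on its last vertex.\<close>

lemma extend_walk_list:
  assumes "walk_list xs" "xs \<noteq> []"
  obtains s' where "survivor_play G s'" "map s' [0..<length xs] = xs"
proof
  let ?s = "\<lambda>r. if r < length xs then xs ! r else last xs"
  show "map ?s [0..<length xs] = xs" by (auto intro: nth_equalityI)
  have "?s (Suc t) = ?s t \<or> (?s t, ?s (Suc t)) \<in> parcs G" for t
  proof (cases "Suc t < length xs")
    case True
    with assms show ?thesis by (auto simp: walk_list_def successively_conv_nth)
  next
    case False
    then have "t < length xs \<Longrightarrow> t = length xs - 1" by simp
    with False assms(2) show ?thesis by (auto simp: last_conv_nth)
  qed
  with assms show "survivor_play G ?s" by (auto simp: survivor_play_def walk_list_def hd_conv_nth)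
qed

text \<open>Links round \<open>r\<close> of the game on \<open>G\<close> to the time in the product
  game at which entry \<open>r\<close> is recorded; the record before that,
  \<open>take r (us T)\<close>, is exactly what \<open>\<sigma>\<close> has seen by then.\<close>

lemma us_nth:
  assumes "r < length (us T)"
  shows "\<exists>t<T. h t = v t \<and> us t = take r (us T) \<and> u t = us T ! r"
  using assms
proof (induction T)
  case (Suc T)
  show ?case
  proof (cases "r < length (us T)")
    case True
    with Suc obtain t where "t < T" "h t = v t" "us t = take r (us T)" "u t = us T ! r" by blast
    with True show ?thesis
      by (intro exI[of _ t]) (auto simp: us_Suc nth_append)
  next
    case False
    with Suc.prems have "h T = v T" "r = length (us T)" by (auto simp: us_Suc split: if_splits)
    then show ?thesis by (intro exI[of _ T]) (auto simp: us_Suc)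
  qed
qed simp

lemma length_us_mono: "t \<le> t' \<Longrightarrow> length (us t) \<le> length (us t')"
  by (rule lift_Suc_mono_le[of "\<lambda>t. length (us t)"]) (simp_all add: us_Suc)

text \<open>When entry \<open>r\<close> is recorded, the team agrees with the survivor in
  \<open>H\<close>, so a zombie on \<open>s' r\<close> in the game on \<open>G\<close> is on the
  survivor's vertex in the product. A capture by a move onto \<open>s' (r - 1)\<close> happens
  earlier, in the round right after entry \<open>r - 1\<close> was recorded.\<close>

lemma caught_projection:
  assumes us: "us T = map s' [0..<n]" and r: "r < n" and c: "caught k \<sigma> s' r"
  shows "\<exists>t<T. caught k \<rho> s t"
proof -
  from c obtain i where i: "i < k" and pos: "\<sigma> (map s' [0..<r]) i = s' (r - 1) \<or>
      \<sigma> (map s' [0..<r]) i = s' r" by (auto simp: caught_def zombie_pos_def)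
  have len: "length (us T) = n" by (simp add: us)
  have take: "take q (us T) = map s' [0..<q]" if "q < n" for q
    using that by (simp add: us take_map)
  obtain t where t: "t < T" "h t = v t" "us t = map s' [0..<r]" "u t = s' r"
    using us_nth[of r T] r len take[OF r] us by auto
  show ?thesis
  proof (cases "\<sigma> (map s' [0..<r]) i = s' r")
    case True
    then have "zombie_pos \<rho> s t i = s t" using t by (simp add: zombie_pos_team prod_eq_iff)
    with i t(1) show ?thesis unfolding caught_def by blast
  next
    case False
    \<comment> \<open>For \<open>r = 0\<close> the truncated subtraction gives
      \<open>r - 1 = r\<close>, which this case excludes.\<close>
    with pos have p: "\<sigma> (map s' [0..<r]) i = s' (r - 1)" "r \<noteq> 0" by (auto intro: gr0I)
    then obtain q where q: "r = Suc q" by (cases r) auto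
    then have "q < n" using r by simp
    then obtain t' where t': "t' < T" "h t' = v t'" "us t' = map s' [0..<q]" "u t' = s' q"
      using us_nth[of q T] len take[of q] us by auto
    \<comment> \<open>Records only grow, so entry \<open>q\<close> was recorded strictly before
      entry \<open>r\<close>; hence \<open>Suc t'\<close> is still before \<open>T\<close>.\<close>
    have "length (us t') < length (us t)" using t t' q by simp
    then have "t' < t" using length_us_mono[of t t'] by (meson not_le)
    moreover have "zombie_pos \<rho> s (Suc t') i = s t'"
      using t' p q by (simp add: zombie_pos_team us_Suc h_Suc prod_eq_iff)
    ultimately have "caught k \<rho> s (Suc t')" "Suc t' < T" using i t(1) by (auto simp: caught_def)
    then show ?thesis by blast
  qed
qed

section \<open>Legality of the team's moves\<close>

lemma team_legal_move:
  assumes nc: "\<And>r. r \<le> t \<Longrightarrow> \<not> caught k \<rho> s r" and i: "i < k"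
    and x: "\<sigma> (us t) i \<in> pverts G"
  shows "zombie_move (G \<box> H) (s t) (zombie_pos \<rho> s t i) (zombie_pos \<rho> s (Suc t) i)"
proof (cases "h t = v t")
  case True
  let ?n = "length (us t)"
  have us': "us (Suc t) = us t @ [u t]" using True by (simp add: us_Suc)
  \<comment> \<open>In the game on \<open>G\<close> this is time \<open>?n\<close>: the zombies
    stand at \<open>\<sigma> (us t)\<close> and see the survivor on \<open>u t\<close>.\<close>
  obtain s' where s': "survivor_play G s'" "map s' [0..<Suc ?n] = us t @ [u t]"
    using extend_walk_list[OF walk_list_us[of "Suc t"]] us' by auto
  \<comment> \<open>A capture in \<open>G\<close> up to time \<open>?n\<close> would by
    \<open>caught_projection\<close> be a capture in the product before \<open>Suc t\<close>, so
    \<open>\<sigma>\<close> is still bound by the rules.\<close>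
  have nc': "\<not> caught k \<sigma> s' r" if "r \<le> ?n" for r
    using caught_projection[of "Suc t" s' "Suc ?n" r] us' s'(2) nc that by (auto simp: less_Suc_eq_le)
  have "zombie_move G (s' ?n) (zombie_pos \<sigma> s' ?n i) (zombie_pos \<sigma> s' (Suc ?n) i)"
    using legal s'(1) nc' i unfolding legal_strategy_def by blast
  moreover have "s' ?n = u t" "map s' [0..<?n] = us t" using s'(2) by auto
  ultimately have "zombie_move G (u t) (\<sigma> (us t) i) (\<sigma> (us (Suc t)) i)"
    using s'(2) us' by (simp add: zombie_pos_def)
  from zombie_move_fst[OF G.pair_wf_digraph H.pair_wf_digraph this h_in_verts[of t]] True show ?thesis
    by (simp add: zombie_pos_team h_Suc)
next
  case False
  then have "zombie_move H (v t) (h t) (h (Suc t))"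
    using f h_in_verts survivor_in_verts by (simp add: h_Suc)
  moreover have "(\<sigma> (us t) i, u t) \<in> (parcs G)\<^sup>*"
    using reach_G x survivor_in_verts by blast
  ultimately have "zombie_move (G \<box> H) (u t, v t) (\<sigma> (us t) i, h t) (\<sigma> (us t) i, h (Suc t))"
    using zombie_move_snd[OF G.pair_wf_digraph H.pair_wf_digraph] x by blast
  then show ?thesis using False by (simp add: zombie_pos_team us_Suc)
qed

text \<open>Legal moves end on vertices, so induction supplies the vertex hypothesis of
  \<open>team_legal_move\<close>.\<close>

lemma team_in_verts:
  assumes nc: "\<And>r. r < t \<Longrightarrow> \<not> caught k \<rho> s r" and i: "i < k"
  shows "\<sigma> (us t) i \<in> pverts G"
  using nc
proof (induction t)
  case 0
  then show ?case using legal i by (simp add: legal_strategy_def)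
next
  case (Suc t)
  interpret P: pair_wf_digraph "G \<box> H"
    by (rule pair_wf_digraph_cartesian_product) auto
  have "zombie_move (G \<box> H) (s t) (zombie_pos \<rho> s t i) (zombie_pos \<rho> s (Suc t) i)"
    using Suc i by (intro team_legal_move) auto
  then have "zombie_pos \<rho> s (Suc t) i \<in> pverts (G \<box> H)"
    unfolding P.zombie_move_iff using P.in_arcsD2 by blast
  then show ?case by (simp add: zombie_pos_team cartesian_product_def)
qed

section \<open>The distance in the second factor, and capture\<close>

definition d :: "nat \<Rightarrow> nat" where
  "d t = (LEAST n. (h t, v t) \<in> parcs H ^^ n)"

lemma d: "(h t, v t) \<in> parcs H ^^ d t" and d_le: "(h t, v t) \<in> parcs H ^^ n \<Longrightarrow> d t \<le> n"
proof -
  have "\<exists>n. (h t, v t) \<in> parcs H ^^ n"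
    using reach_H[OF h_in_verts[of t]] survivor_in_verts[of t] by (simp add: rtrancl_power)
  then show "(h t, v t) \<in> parcs H ^^ d t" unfolding d_def by (rule LeastI_ex)
qed (simp add: d_def Least_le)

text \<open>The team's step brings it one closer to the survivor's old second coordinate, and the
  survivor's move in \<open>H\<close> adds at most one.\<close>

lemma d_Suc:
  assumes "h t \<noteq> v t"
  shows "d (Suc t) \<le> d t" and "v (Suc t) = v t \<Longrightarrow> d (Suc t) < d t"
proof -
  from assms f[of "h t" "v t"] h_in_verts survivor_in_verts
  obtain n where n: "(h (Suc t), v t) \<in> parcs H ^^ n" "\<forall>m\<le>n. (h t, v t) \<notin> parcs H ^^ m"
    by (auto simp: H.zombie_move_iff h_Suc)
  have "n < d t" using n(2) d[of t] by (meson not_le)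
  show lt: "d (Suc t) < d t" if "v (Suc t) = v t"
    using d_le[of "Suc t" n] n(1) that \<open>n < d t\<close> by simp
  show "d (Suc t) \<le> d t"
  proof (cases "v (Suc t) = v t")
    case False
    with survivor_move[of t] have "(v t, v (Suc t)) \<in> parcs H" by auto
    with n(1) have "(h (Suc t), v (Suc t)) \<in> parcs H ^^ Suc n" by auto
    from d_le[OF this] \<open>n < d t\<close> show ?thesis by simp
  qed (use lt in simp)
qed

lemma infinitely_often_shadowed:
  assumes "\<forall>T. \<exists>t\<ge>T. v (Suc t) = v t"
  shows "\<exists>t\<ge>T. h t = v t"
proof (rule ccontr)
  assume "\<not> ?thesis"
  then have ne: "\<And>t. t \<ge> T \<Longrightarrow> h t \<noteq> v t" by auto
  \<comment> \<open>\<open>d\<close> attains its minimum from \<open>T\<close> on at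
    \<open>t\<close>; since it never grows afterwards, the next survivor's move not in
    \<open>H\<close>, at \<open>t'\<close>, pushes it below that minimum.\<close>
  obtain t where t: "t \<ge> T" "\<And>t'. t' \<ge> T \<Longrightarrow> d t \<le> d t'"
    using ex_has_least_nat[of "\<lambda>t. t \<ge> T" T d] by auto
  obtain t' where t': "t' \<ge> t" "v (Suc t') = v t'" using assms by blast
  have "d t' \<le> d t" using t'(1)
  proof (induction t' rule: dec_induct)
    case (step n)
    then show ?case using d_Suc(1)[of n] ne[of n] t(1) by simp
  qed simp
  with d_Suc(2)[OF ne t'(2)] t' t(1) t(2)[of "Suc t'"] show False by simp
qed

lemma length_us_unbounded:
  assumes "\<forall>T. \<exists>t\<ge>T. v (Suc t) = v t"
  shows "\<exists>T. n \<le> length (us T)"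
proof (induction n)
  case (Suc n)
  then obtain T where "n \<le> length (us T)" by blast
  moreover obtain t where "t \<ge> T" "h t = v t" using infinitely_often_shadowed[OF assms] by blast
  ultimately have "Suc n \<le> length (us (Suc t))" using length_us_mono[of T t] by (simp add: us_Suc)
  then show ?case by blast
qed simp

lemma us_prefix:
  assumes "t \<le> T"
  shows "us t = take (length (us t)) (us T)"
  using assms
proof (induction T rule: dec_induct)
  case (step T)
  then show ?case using length_us_mono[of t T] by (auto simp: us_Suc)
qed simp

text \<open>The records are prefixes of one another and grow without bound, so they have a limit
  \<open>s'\<close>. It is an infinite play in \<open>G\<close>, against which
  \<open>\<sigma>\<close> wins.\<close>

lemma team_catches:
  assumes inf: "\<forall>T. \<exists>t\<ge>T. v (Suc t) = v t"
    and win: "\<And>s'. survivor_play G s' \<Longrightarrow> \<exists>t. caught k \<sigma> s' t"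
  shows "\<exists>t. caught k \<rho> s t"
proof -
  \<comment> \<open>\<open>\<tau> n\<close> is a time by which \<open>n\<close> entries have been
    recorded.\<close>
  obtain \<tau> where \<tau>: "\<And>n. n \<le> length (us (\<tau> n))"
    using length_us_unbounded[OF inf] by metis
  define s' where "s' r = us (\<tau> (Suc r)) ! r" for r
  have nth: "s' r = us T ! r" if "r < length (us T)" for r T
  proof (cases "T \<le> \<tau> (Suc r)")
    case True
    from us_prefix[OF this] that show ?thesis by (metis s'_def nth_take)
  next
    case False
    then have "us (\<tau> (Suc r)) = take (length (us (\<tau> (Suc r)))) (us T)" by (intro us_prefix) simp
    with \<tau>[of "Suc r"] show ?thesis by (metis s'_def nth_take Suc_le_lessD)
  qed
  have us: "us T = map s' [0..<length (us T)]" for T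
    by (rule nth_equalityI) (simp_all add: nth)
  have "walk_list (map s' [0..<n])" for n
  proof -
    have "us (\<tau> n) = map s' [0..<n] @ map s' [n..<length (us (\<tau> n))]"
      using us[of "\<tau> n"] \<tau>[of n] by (metis le_add_diff_inverse map_append upt_add_eq_append zero_le)
    with walk_list_us[of "\<tau> n"] show ?thesis by (metis walk_list_appendD)
  qed
  then obtain r where "caught k \<sigma> s' r" using win survivor_play_walk_list by blast
  \<comment> \<open>The record at \<open>\<tau> (Suc r)\<close> contains entry \<open>r\<close>, as
    \<open>caught_projection\<close> requires.\<close>
  with caught_projection[OF us[of "\<tau> (Suc r)"], of r] \<tau>[of "Suc r"] show ?thesis by auto
qed

end

text \<open>The condition on \<open>s\<close> is what makes the recorded play infinite; the
  remaining plays are left to the other team.\<close>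

lemma winning_strategy_imp_team_strategy:
  assumes G: "pair_graph G" "connected (with_proj G)" and H: "pair_graph H" "connected (with_proj H)"
    and win: "winning_strategy G k \<sigma>"
  obtains \<rho> where "legal_strategy (G \<box> H) k \<rho>"
    and "\<And>s. survivor_play (G \<box> H) s \<Longrightarrow> \<forall>T. \<exists>t\<ge>T. snd (s (Suc t)) = snd (s t) \<Longrightarrow>
           \<exists>t. caught k \<rho> s t"
proof -
  interpret H: pair_graph H by fact
  obtain h\<^sub>0 where h\<^sub>0: "h\<^sub>0 \<in> pverts H"
    using H(2) by (auto simp: connected_def strongly_connected_def)
  obtain f where f: "zombie_move H v h (f h v)"
    if "h \<in> pverts H" "v \<in> pverts H" "h \<noteq> v" for h v
    using H.exists_zombie_move connected_imp_rtrancl[OF H] by metis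
  have team: "team_play G H f h\<^sub>0 k \<sigma> s" if "survivor_play (G \<box> H) s" for s
    using that win h\<^sub>0 f by (intro team_play.intro G(1) H(1) connected_imp_rtrancl[OF G]
        connected_imp_rtrancl[OF H]) (auto simp: winning_strategy_def)
  let ?\<rho> = "team_strategy f h\<^sub>0 \<sigma>"
  have "legal_strategy (G \<box> H) k ?\<rho>"
    unfolding legal_strategy_def
  proof (intro conjI allI impI)
    fix i assume "i < k"
    with win h\<^sub>0 show "?\<rho> [] i \<in> pverts (G \<box> H)"
      by (simp add: team_strategy_def team_state_def winning_strategy_def legal_strategy_def
          cartesian_product_def)
  next
    fix s t i
    assume "survivor_play (G \<box> H) s \<and> (\<forall>r\<le>t. \<not> caught k ?\<rho> s r)" and i: "i < k"
    then have s: "survivor_play (G \<box> H) s" and nc: "\<And>r. r \<le> t \<Longrightarrow> \<not> caught k ?\<rho> s r" by auto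
    interpret team_play G H f h\<^sub>0 k \<sigma> s by (rule team[OF s])
    show "zombie_move (G \<box> H) (s t) (zombie_pos ?\<rho> s t i) (zombie_pos ?\<rho> s (Suc t) i)"
      using nc i by (intro team_legal_move team_in_verts) auto
  qed
  moreover have "\<exists>t. caught k ?\<rho> s t"
    if "survivor_play (G \<box> H) s" "\<forall>T. \<exists>t\<ge>T. snd (s (Suc t)) = snd (s t)" for s
    using team_play.team_catches[OF team] that win by (auto simp: winning_strategy_def)
  ultimately show ?thesis by (rule that)
qed

subsection \<open>Combining the two teams\<close>

lemma zombie_move_swap:
  assumes "pair_wf_digraph G" "pair_wf_digraph H"
  shows "zombie_move (H \<box> G) (prod.swap v) (prod.swap x) (prod.swap y) \<longleftrightarrow> zombie_move (G \<box> H) v x y"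
proof -
  interpret GH: pair_wf_digraph "G \<box> H" using assms by (rule pair_wf_digraph_cartesian_product)
  interpret HG: pair_wf_digraph "H \<box> G"
    using assms(2,1) by (rule pair_wf_digraph_cartesian_product)
  show ?thesis
    using arc_swap[of x y H G] by (simp add: GH.zombie_move_iff HG.zombie_move_iff relpow_swap)
qed

lemma survivor_play_swap:
  "survivor_play (H \<box> G) (\<lambda>t. prod.swap (s t)) \<longleftrightarrow> survivor_play (G \<box> H) s"
proof -
  have "prod.swap (s 0) \<in> pverts (H \<box> G) \<longleftrightarrow> s 0 \<in> pverts (G \<box> H)"
    by (cases "s 0") (auto simp: cartesian_product_def)
  then show ?thesis by (simp add: survivor_play_def arc_swap inj_eq[OF inj_swap])
qed

definition swap_strategy :: "('a \<times> 'b) zombie_strategy \<Rightarrow> ('b \<times> 'a) zombie_strategy" where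
  "swap_strategy \<rho> ps i = prod.swap (\<rho> (map prod.swap ps) i)"

lemma zombie_pos_swap:
  "zombie_pos (swap_strategy \<rho>) s t i = prod.swap (zombie_pos \<rho> (\<lambda>t. prod.swap (s t)) t i)"
  by (simp add: zombie_pos_def swap_strategy_def comp_def)

lemma swap_eq_iff: "prod.swap p = q \<longleftrightarrow> p = prod.swap q"
  by auto

lemma caught_swap: "caught k (swap_strategy \<rho>) s t \<longleftrightarrow> caught k \<rho> (\<lambda>t. prod.swap (s t)) t"
  by (simp add: caught_def zombie_pos_swap swap_eq_iff)

lemma legal_strategy_swap:
  assumes wf: "pair_wf_digraph G" "pair_wf_digraph H" and legal: "legal_strategy (H \<box> G) k \<rho>"
  shows "legal_strategy (G \<box> H) k (swap_strategy \<rho>)"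
  unfolding legal_strategy_def
proof (intro conjI allI impI)
  fix i assume "i < k"
  then have "\<rho> [] i \<in> pverts (H \<box> G)" using legal by (simp add: legal_strategy_def)
  then show "swap_strategy \<rho> [] i \<in> pverts (G \<box> H)"
    by (auto simp: swap_strategy_def cartesian_product_def)
next
  fix s t i
  assume asm: "survivor_play (G \<box> H) s \<and> (\<forall>r\<le>t. \<not> caught k (swap_strategy \<rho>) s r)" and i: "i < k"
  let ?s = "\<lambda>t. prod.swap (s t)"
  from asm have "survivor_play (H \<box> G) ?s" "\<forall>r\<le>t. \<not> caught k \<rho> ?s r"
    by (simp_all add: survivor_play_swap caught_swap)
  with legal i have "zombie_move (H \<box> G) (?s t) (zombie_pos \<rho> ?s t i) (zombie_pos \<rho> ?s (Suc t) i)"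
    unfolding legal_strategy_def by blast
  then show "zombie_move (G \<box> H) (s t) (zombie_pos (swap_strategy \<rho>) s t i)
      (zombie_pos (swap_strategy \<rho>) s (Suc t) i)"
    by (simp add: zombie_pos_swap flip: zombie_move_swap[OF wf])
qed

definition join_strategies :: "nat \<Rightarrow> 'a zombie_strategy \<Rightarrow> 'a zombie_strategy \<Rightarrow> 'a zombie_strategy" where
  "join_strategies k \<rho> \<rho>' ps i = (if i < k then \<rho> ps i else \<rho>' ps (i - k))"

lemma zombie_pos_join:
  "zombie_pos (join_strategies k \<rho> \<rho>') s t i =
     (if i < k then zombie_pos \<rho> s t i else zombie_pos \<rho>' s t (i - k))"
  by (simp add: zombie_pos_def join_strategies_def)

lemma caught_join:
  "caught (k + l) (join_strategies k \<rho> \<rho>') s t \<longleftrightarrow> caught k \<rho> s t \<or> caught l \<rho>' s t" (is "?L \<longleftrightarrow> ?R")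
proof
  assume ?L
  then obtain i where "i < k + l" "zombie_pos (join_strategies k \<rho> \<rho>') s t i \<in> {s (t - 1), s t}"
    by (auto simp: caught_def)
  moreover then have "\<not> i < k \<Longrightarrow> i - k < l" by simp
  ultimately show ?R unfolding caught_def zombie_pos_join by (cases "i < k") auto
next
  assume ?R
  then show ?L
  proof
    assume "caught k \<rho> s t"
    then obtain i where "i < k" "zombie_pos \<rho> s t i \<in> {s (t - 1), s t}" by (auto simp: caught_def)
    then show ?L unfolding caught_def zombie_pos_join by (intro exI[of _ i]) auto
  next
    assume "caught l \<rho>' s t"
    then obtain i where "i < l" "zombie_pos \<rho>' s t i \<in> {s (t - 1), s t}" by (auto simp: caught_def)
    then show ?L unfolding caught_def zombie_pos_join by (intro exI[of _ "k + i"]) auto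
  qed
qed

text \<open>As long as the joint team has made no capture, neither team has made one, so the
  legality of each team's own strategy applies to its members.\<close>

lemma legal_strategy_join:
  assumes "legal_strategy P k \<rho>" "legal_strategy P l \<rho>'"
  shows "legal_strategy P (k + l) (join_strategies k \<rho> \<rho>')"
  using assms unfolding legal_strategy_def caught_join zombie_pos_join
  by (auto simp: join_strategies_def)

theorem theorem1:
  fixes G :: "'a pair_pre_digraph" and H :: "'b pair_pre_digraph"
  assumes "pair_graph G" and "connected G"
    and "pair_graph H" and "connected H"
  shows "zombie_number (G \<box> H) \<le> zombie_number G + zombie_number H"
proof -
  let ?k = "zombie_number G" and ?l = "zombie_number H"
  interpret G: pair_graph G by fact
  interpret H: pair_graph H by fact
  obtain \<sigma> where "winning_strategy G ?k \<sigma>"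
    unfolding zombie_number_def using LeastI_ex[OF winning_strategy_exists[OF assms(1)]] by blast
  then obtain \<rho> where \<rho>: "legal_strategy (G \<box> H) ?k \<rho>"
    "\<And>s. survivor_play (G \<box> H) s \<Longrightarrow> \<forall>T. \<exists>t\<ge>T. snd (s (Suc t)) = snd (s t) \<Longrightarrow> \<exists>t. caught ?k \<rho> s t"
    using winning_strategy_imp_team_strategy[OF assms] by blast
  obtain \<sigma>' where "winning_strategy H ?l \<sigma>'"
    unfolding zombie_number_def using LeastI_ex[OF winning_strategy_exists[OF assms(3)]] by blast
  then obtain \<rho>' where \<rho>': "legal_strategy (H \<box> G) ?l \<rho>'"
    "\<And>s. survivor_play (H \<box> G) s \<Longrightarrow> \<forall>T. \<exists>t\<ge>T. snd (s (Suc t)) = snd (s t) \<Longrightarrow> \<exists>t. caught ?l \<rho>' s t"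
    using winning_strategy_imp_team_strategy[OF assms(3,4,1,2)] by blast
  let ?\<rho> = "join_strategies ?k \<rho> (swap_strategy \<rho>')"
  have "legal_strategy (G \<box> H) (?k + ?l) ?\<rho>"
    using \<rho>(1) legal_strategy_swap[OF G.pair_wf_digraph H.pair_wf_digraph \<rho>'(1)]
    by (rule legal_strategy_join)
  moreover have "\<exists>t. caught (?k + ?l) ?\<rho> s t" if s: "survivor_play (G \<box> H) s" for s
  proof (cases "\<forall>T. \<exists>t\<ge>T. snd (s (Suc t)) = snd (s t)")
    case True
    with \<rho>(2)[OF s] show ?thesis by (auto simp: caught_join)
  next
    case False
    then obtain T where T: "\<And>t. t \<ge> T \<Longrightarrow> snd (s (Suc t)) \<noteq> snd (s t)" by blast
    have "fst (s (Suc t)) = fst (s t)" if "t \<ge> T" for t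
    proof -
      have "s (Suc t) = s t \<or> (s t, s (Suc t)) \<in> parcs (G \<box> H)"
        using s by (simp add: survivor_play_def)
      with T[OF that] show ?thesis by (auto simp: cartesian_product_def split_beta)
    qed
    \<comment> \<open>At time \<open>max T T'\<close> the survivor moves in \<open>H\<close>, so the
      first coordinate stays. This case therefore belongs to the second team, with the factors
      exchanged.\<close>
    then have "\<forall>T'. \<exists>t\<ge>T'. fst (s (Suc t)) = fst (s t)" by (meson max.cobounded1 max.cobounded2)
    with \<rho>'(2)[of "\<lambda>t. prod.swap (s t)"] s show ?thesis
      by (auto simp: caught_join caught_swap survivor_play_swap)
  qed
  ultimately have "\<exists>\<rho>. winning_strategy (G \<box> H) (?k + ?l) \<rho>" by (auto simp: winning_strategy_def)
  then show ?thesis unfolding zombie_number_def[of "G \<box> H"] by (rule Least_le)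
qed

end
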